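(* Let $n\ge 1$ be an integer and let $a_1,\dots,a_{n+1}>0$ be real numbers with $\sum_{i=1}^{n+1}a_i^2=1$. Identify $R^{2n+2}$ with $C^{n+1}$ and let $$T^{n+1}=\{(z_1,\dots,z_{n+1})\in C^{n+1}: |z_i|=a_i \text{ for } i=1,\dots,n+1\}\subset S^{2n+1}.$$ Then $T^{n+1}$ is biharmonic in $S^{2n+1}$ if and only if, for every $i=1,\dots,n+1$, $$a_i d-\frac{1}{a_i^3}=2(n+1)\left((n+1)a_i-\frac{1}{a_i}\right),$$ where $d=\sum_{j=1}^{n+1}\frac{1}{a_j^2}$.
   Context: $S^{2n+1}$ is the unit sphere in $R^{2n+2}=C^{n+1}$ with its standard metric. For a smooth map $\phi:(M,g)\to(N,h)$ of Riemannian manifolds, the tension field is $\tau(\phi)=\mathrm{trace}\,\nabla d\phi$. The map $\phi$ is biharmonic if it is a critical point of the bienergy $E_2(\phi)=\frac12\int_M|\tau(\phi)|^2 v_g$, equivalently if the bitension field $$\tau_2(\phi)=-\Delta^\phi\tau(\phi)-\mathrm{trace}\,R^N(d\phi,\tau(\phi))d\phi$$ vanishes, where $\Delta^\phi=-\mathrm{trace}\,(\nabla^\phi)^2$ is the rough Laplacian on sections of $\phi^{-1}TN$ and $R^N(X,Y)=[\nabla_X,\nabla_Y]-\nabla_{[X,Y]}$. A submanifold, with the induced metric, is called biharmonic if its inclusion map is biharmonic (minimal submanifolds are biharmonic). *)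

theory Defs
  imports "HOL-Analysis.Analysis"
begin

text \<open>
  All manifolds are submanifolds of Euclidean spaces and carry the induced metric.  A vector field
  on \<open>M\<close>, or a section along a map \<open>\<phi> : M \<rightarrow> N\<close>, is a function into the ambient vector space whose
  value at \<open>p\<close> lies in the tangent space at \<open>p\<close>, or at \<open>\<phi> p\<close>; only its values on \<open>M\<close> matter.
\<close>

primrec times_differentiable_on ::
  "nat \<Rightarrow> 'a::euclidean_space set \<Rightarrow> ('a \<Rightarrow> 'b::euclidean_space) \<Rightarrow> bool" where
  "times_differentiable_on 0 U f \<longleftrightarrow> continuous_on U f"
| "times_differentiable_on (Suc k) U f \<longleftrightarrow>
     (\<forall>x\<in>U. f differentiable (at x)) \<and>
     (\<forall>v. times_differentiable_on k U (\<lambda>x. frechet_derivative f (at x) v))"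

text \<open>The following is meant for open \<open>U\<close>.\<close>

definition smooth_on :: "'a::euclidean_space set \<Rightarrow> ('a \<Rightarrow> 'b::euclidean_space) \<Rightarrow> bool" where
  "smooth_on U f \<longleftrightarrow> (\<forall>k. times_differentiable_on k U f)"

text \<open>
  A submanifold is locally the zero set of a submersion; the common target \<open>L\<close> of these
  submersions has dimension the codimension of \<open>M\<close>.
\<close>

definition embedded_submanifold :: "'a::euclidean_space set \<Rightarrow> bool" where
  "embedded_submanifold M \<longleftrightarrow>
     (\<exists>L :: 'a set. subspace L \<and>
        (\<forall>p\<in>M. \<exists>U F. open U \<and> p \<in> U \<and> smooth_on U F \<and> F ` U \<subseteq> L \<and>
           M \<inter> U = {x \<in> U. F x = 0} \<and>
           (\<forall>x \<in> M \<inter> U. range (frechet_derivative F (at x)) = L)))"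

definition smooth_map ::
  "'a::euclidean_space set \<Rightarrow> 'b::euclidean_space set \<Rightarrow> ('a \<Rightarrow> 'b) \<Rightarrow> bool" where
  "smooth_map M N \<phi> \<longleftrightarrow> \<phi> ` M \<subseteq> N \<and>
     (\<forall>p\<in>M. \<exists>U f. open U \<and> p \<in> U \<and> smooth_on U f \<and> (\<forall>x \<in> M \<inter> U. f x = \<phi> x))"

definition tangent_space :: "'a::euclidean_space set \<Rightarrow> 'a \<Rightarrow> 'a set" where
  "tangent_space M p =
     {v. \<exists>\<gamma> \<epsilon>. 0 < \<epsilon> \<and> smooth_on {-\<epsilon><..<\<epsilon>} \<gamma> \<and> \<gamma> ` {-\<epsilon><..<\<epsilon>} \<subseteq> M \<and> \<gamma> 0 = p \<and>
        (\<gamma> has_vector_derivative v) (at (0::real))}"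

definition tangent_proj :: "'a::euclidean_space set \<Rightarrow> 'a \<Rightarrow> 'a \<Rightarrow> 'a" where
  "tangent_proj M p v =
     (THE w. w \<in> tangent_space M p \<and> (\<forall>u \<in> tangent_space M p. (v - w) \<bullet> u = 0))"

text \<open>
  \<open>diff M f p v\<close> is the derivative of \<open>f\<close> along \<open>v\<close>.  A derivative within \<open>M\<close> need not be
  unique as a linear map on the ambient space, but its restriction to the tangent space
  \<open>T\<^sub>p M\<close> is; it is only ever applied to tangent vectors.
\<close>

definition diff ::
  "'a::euclidean_space set \<Rightarrow> ('a \<Rightarrow> 'b::euclidean_space) \<Rightarrow> 'a \<Rightarrow> 'a \<Rightarrow> 'b" where
  "diff M f p v = frechet_derivative f (at p within M) v"

text \<open>
  The Levi-Civita connection of the metric induced on \<open>N\<close> by the ambient Euclidean space is the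
  tangential part of the ambient derivative.  \<open>nabla M N \<phi>\<close> is its pull-back to sections along
  \<open>\<phi>\<close>; the Levi-Civita connection of \<open>M\<close> itself is the case of the identity map.
\<close>

definition nabla ::
  "'a::euclidean_space set \<Rightarrow> 'b::euclidean_space set \<Rightarrow> ('a \<Rightarrow> 'b) \<Rightarrow>
   ('a \<Rightarrow> 'a) \<Rightarrow> ('a \<Rightarrow> 'b) \<Rightarrow> 'a \<Rightarrow> 'b" where
  "nabla M N \<phi> X V = (\<lambda>p. tangent_proj N (\<phi> p) (diff M V p (X p)))"

abbreviation levi_civita ::
  "'a::euclidean_space set \<Rightarrow> ('a \<Rightarrow> 'a) \<Rightarrow> ('a \<Rightarrow> 'a) \<Rightarrow> 'a \<Rightarrow> 'a" where
  "levi_civita M \<equiv> nabla M M (\<lambda>x. x)"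

definition lie_bracket ::
  "'a::euclidean_space set \<Rightarrow> ('a \<Rightarrow> 'a) \<Rightarrow> ('a \<Rightarrow> 'a) \<Rightarrow> 'a \<Rightarrow> 'a" where
  "lie_bracket M X Y = (\<lambda>p. diff M Y p (X p) - diff M X p (Y p))"

text \<open>
  A smooth vector field on \<open>M\<close> which takes the value \<open>v\<close> at \<open>p\<close> whenever \<open>v\<close> is tangent to \<open>M\<close> at
  \<open>p\<close>.  The expressions evaluated on such extensions below are tensorial, so the choice of
  extension does not matter.
\<close>

definition extend :: "'a::euclidean_space set \<Rightarrow> 'a \<Rightarrow> 'a \<Rightarrow> 'a" where
  "extend M v = (\<lambda>q. tangent_proj M q v)"

definition curvature_op ::
  "'a::euclidean_space set \<Rightarrow> ('a \<Rightarrow> 'a) \<Rightarrow> ('a \<Rightarrow> 'a) \<Rightarrow> ('a \<Rightarrow> 'a) \<Rightarrow> 'a \<Rightarrow> 'a" where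
  "curvature_op M X Y Z = (\<lambda>p.
     levi_civita M X (levi_civita M Y Z) p - levi_civita M Y (levi_civita M X Z) p
     - levi_civita M (lie_bracket M X Y) Z p)"

definition curvature :: "'a::euclidean_space set \<Rightarrow> 'a \<Rightarrow> 'a \<Rightarrow> 'a \<Rightarrow> 'a \<Rightarrow> 'a" where
  "curvature M p x y z = curvature_op M (extend M x) (extend M y) (extend M z) p"

definition orthonormal_basis :: "'a::euclidean_space set \<Rightarrow> 'a set \<Rightarrow> bool" where
  "orthonormal_basis T B \<longleftrightarrow>
     B \<subseteq> T \<and> span B = T \<and> pairwise orthogonal B \<and> (\<forall>b\<in>B. norm b = 1)"

text \<open>For bilinear \<open>b\<close> this does not depend on the orthonormal basis.\<close>

definition trace_on ::
  "'a::euclidean_space set \<Rightarrow> ('a \<Rightarrow> 'a \<Rightarrow> 'b::real_vector) \<Rightarrow> 'b" where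
  "trace_on T b = (\<Sum>e \<in> (SOME B. orthonormal_basis T B). b e e)"

definition nabla_d ::
  "'a::euclidean_space set \<Rightarrow> 'b::euclidean_space set \<Rightarrow> ('a \<Rightarrow> 'b) \<Rightarrow>
   ('a \<Rightarrow> 'a) \<Rightarrow> ('a \<Rightarrow> 'a) \<Rightarrow> 'a \<Rightarrow> 'b" where
  "nabla_d M N \<phi> X Y = (\<lambda>p.
     nabla M N \<phi> X (\<lambda>q. diff M \<phi> q (Y q)) p - diff M \<phi> p (levi_civita M X Y p))"

definition tension ::
  "'a::euclidean_space set \<Rightarrow> 'b::euclidean_space set \<Rightarrow> ('a \<Rightarrow> 'b) \<Rightarrow> 'a \<Rightarrow> 'b" where
  "tension M N \<phi> p =
     trace_on (tangent_space M p) (\<lambda>v w. nabla_d M N \<phi> (extend M v) (extend M w) p)"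

definition nabla2 ::
  "'a::euclidean_space set \<Rightarrow> 'b::euclidean_space set \<Rightarrow> ('a \<Rightarrow> 'b) \<Rightarrow>
   ('a \<Rightarrow> 'a) \<Rightarrow> ('a \<Rightarrow> 'a) \<Rightarrow> ('a \<Rightarrow> 'b) \<Rightarrow> 'a \<Rightarrow> 'b" where
  "nabla2 M N \<phi> X Y V = (\<lambda>p.
     nabla M N \<phi> X (nabla M N \<phi> Y V) p - nabla M N \<phi> (levi_civita M X Y) V p)"

definition rough_laplacian ::
  "'a::euclidean_space set \<Rightarrow> 'b::euclidean_space set \<Rightarrow> ('a \<Rightarrow> 'b) \<Rightarrow>
   ('a \<Rightarrow> 'b) \<Rightarrow> 'a \<Rightarrow> 'b" where
  "rough_laplacian M N \<phi> V p =
     - trace_on (tangent_space M p) (\<lambda>v w. nabla2 M N \<phi> (extend M v) (extend M w) V p)"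

definition bitension ::
  "'a::euclidean_space set \<Rightarrow> 'b::euclidean_space set \<Rightarrow> ('a \<Rightarrow> 'b) \<Rightarrow> 'a \<Rightarrow> 'b" where
  "bitension M N \<phi> p =
     - rough_laplacian M N \<phi> (tension M N \<phi>) p
     - trace_on (tangent_space M p)
         (\<lambda>v w. curvature N (\<phi> p) (diff M \<phi> p v) (tension M N \<phi> p) (diff M \<phi> p w))"

definition biharmonic_map ::
  "'a::euclidean_space set \<Rightarrow> 'b::euclidean_space set \<Rightarrow> ('a \<Rightarrow> 'b) \<Rightarrow> bool" where
  "biharmonic_map M N \<phi> \<longleftrightarrow> smooth_map M N \<phi> \<and> (\<forall>p\<in>M. bitension M N \<phi> p = 0)"

definition biharmonic_submanifold :: "'a::euclidean_space set \<Rightarrow> 'a set \<Rightarrow> bool" where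
  "biharmonic_submanifold M N \<longleftrightarrow>
     embedded_submanifold M \<and> embedded_submanifold N \<and> M \<subseteq> N \<and>
     biharmonic_map M N (\<lambda>x. x)"

definition torus :: "('n::finite \<Rightarrow> real) \<Rightarrow> (complex ^ 'n) set" where
  "torus a = {z. \<forall>i. norm (z $ i) = a i}"

end

theory Submission
  imports Defs
begin

text \<open>
  The torus is an orbit of the group of diagonal unitary matrices, which acts on the sphere by
  isometries; conjugation of a single coordinate is an isometry that preserves the torus as well.
  By this symmetry the tension and bitension fields are diagonal: they have the form
  \<open>z \<mapsto> (c\<^sub>1 z\<^sub>1, \<dots>, c\<^sub>m z\<^sub>m)\<close> with real constants \<open>c\<^sub>i\<close>, where \<open>m\<close> is the number of coordinates.
  The proof computes these constants.

  The tangent space of the torus at \<open>z\<close> consists of the \<open>v\<close> with each \<open>v\<^sub>i\<close> perpendicular to \<open>z\<^sub>i\<close>.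
  Hence differentiating the tangential extension of \<open>w\<close> in the direction \<open>v\<close> gives
  \<open>- (w\<^sub>i \<bullet> v\<^sub>i / a\<^sub>i\<^sup>2) z\<^sub>i\<close> in the \<open>i\<close>th coordinate (\<open>diff_cscale_extend_torus\<close>), which is normal to
  the torus.  All quadratic forms in \<open>v\<close> that have to be traced are linear in the numbers
  \<open>\<bar>v\<^sub>i\<bar>\<^sup>2\<close>, and over an orthonormal basis of the tangent space each of these numbers sums to \<open>1\<close>
  (\<open>trace_on_tangent_torus\<close>).  The tension field is then the diagonal field with coefficients
  \<open>c\<^sub>i = m - 1 / a\<^sub>i\<^sup>2\<close> (\<open>tension_torus\<close>), and the rough Laplacian of a diagonal field has coefficients
  \<open>c\<^sub>i / a\<^sub>i\<^sup>2 - \<Sum>\<^sub>j c\<^sub>j\<close> (\<open>rough_laplacian_cscale_torus\<close>).  The sphere has constant curvature \<open>1\<close>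
  (\<open>curvature_sphere\<close>) and the tension field is normal to the torus, so the curvature term of the
  bitension field is \<open>m\<close> times the tension field.
  
  Adding up, the \<open>i\<close>th coefficient of the bitension field is
  \<open>2m\<^sup>2 - d - 2m / a\<^sub>i\<^sup>2 + 1 / a\<^sub>i\<^sup>4\<close> (\<open>bitension_torus\<close>).  As no \<open>z\<^sub>i\<close> vanishes on the torus, the field
  is zero exactly if all coefficients are, and \<open>-a\<^sub>i\<close> times the \<open>i\<close>th coefficient is the difference of
  the two sides of the stated equation.
  
  All covariant derivatives reduce to ordinary ones of explicit formulas on the ambient space: a
  derivative within a submanifold is determined on tangent vectors by the curves that represent
  them, so it agrees there with the derivative of any extension (\<open>diff_eq_ambient_derivative\<close>).
\<close>

section \<open>Smoothness from closure under differentiation\<close>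

text \<open>
  Smoothness by coinduction: iterated directional derivatives never leave a class of functions that
  is closed under differentiation.  The three functions needed later (defining equations, great
  circles, linear flows on the torus) each lie in such a class.
\<close>

lemma smooth_on_if_derivatives_closed:
  assumes "P f"
    and closed: "\<And>f. P f \<Longrightarrow> \<exists>f'. \<forall>x. (f has_derivative f' x) (at x) \<and> (\<forall>v. P (\<lambda>x. f' x v))"
  shows "smooth_on U f"
proof -
  have "times_differentiable_on k U g" if "P g" for k g
    using that
  proof (induction k arbitrary: g)
    case 0
    obtain g' where "\<And>x. (g has_derivative g' x) (at x)"
      using closed[OF 0] by blast
    then show ?case
      by (auto intro!: continuous_at_imp_continuous_on has_derivative_continuous)
  next
    case (Suc k)
    obtain g' where g': "\<And>x. (g has_derivative g' x) (at x)" "\<And>v. P (\<lambda>x. g' x v)"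
      using closed[OF Suc.prems] by blast
    have "frechet_derivative g (at x) = g' x" for x
      using frechet_derivative_at[OF g'(1)] by simp
    then show ?case
      using Suc.IH g' by (auto simp: differentiable_def)
  qed
  with \<open>P f\<close> show ?thesis
    by (simp add: smooth_on_def)
qed

lemma smooth_on_quadratic:
  fixes B :: "'a::euclidean_space \<Rightarrow> 'a \<Rightarrow> 'b::euclidean_space"
  assumes "bounded_bilinear B" "bounded_linear L"
  shows "smooth_on U (\<lambda>x. B x x + L x + c)"
proof -
  define P :: "('a \<Rightarrow> 'b) \<Rightarrow> bool" where
    "P f \<longleftrightarrow> (\<exists>B L c. bounded_bilinear B \<and> bounded_linear L \<and> f = (\<lambda>x. B x x + L x + c))" for f
  show ?thesis
  proof (rule smooth_on_if_derivatives_closed[where P = P])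
    show "P (\<lambda>x. B x x + L x + c)"
      using assms unfolding P_def by blast
  next
    fix f assume "P f"
    then obtain B L c where B: "bounded_bilinear B" and L: "bounded_linear L"
      and f: "f = (\<lambda>x. B x x + L x + c)"
      unfolding P_def by blast
    define f' where "f' x v = B x v + B v x + L v" for x v
    have "(f has_derivative f' x) (at x)" for x
      unfolding f f'_def
      by (rule derivative_eq_intros bounded_bilinear.FDERIV[OF B]
          bounded_linear.has_derivative[OF L] refl | simp)+
    moreover have "P (\<lambda>x. f' x v)" for v
    proof -
      have "bounded_linear (\<lambda>x. B x v + B v x)"
        by (intro bounded_linear_add bounded_bilinear.bounded_linear_left[OF B]
            bounded_bilinear.bounded_linear_right[OF B])
      moreover have "bounded_bilinear (\<lambda>(x::'a) (y::'a). 0::'b)"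
        by (simp flip: bilinear_conv_bounded_bilinear add: bilinear_def linear_iff)
      moreover have "(\<lambda>x. f' x v) = (\<lambda>x. 0 + (B x v + B v x) + L v)"
        by (simp add: f'_def)
      ultimately show ?thesis
        unfolding P_def by blast
    qed
    ultimately show "\<exists>f'. \<forall>x. (f has_derivative f' x) (at x) \<and> (\<forall>v. P (\<lambda>x. f' x v))"
      by blast
  qed
qed

lemma smooth_on_circle:
  fixes A B :: "'a::euclidean_space"
  shows "smooth_on U (\<lambda>s::real. cos (k * s) *\<^sub>R A + sin (k * s) *\<^sub>R B)"
proof -
  define P :: "(real \<Rightarrow> 'a) \<Rightarrow> bool" where
    "P f \<longleftrightarrow> (\<exists>A B. f = (\<lambda>s. cos (k * s) *\<^sub>R A + sin (k * s) *\<^sub>R B))" for f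
  show ?thesis
  proof (rule smooth_on_if_derivatives_closed[where P = P])
    show "P (\<lambda>s. cos (k * s) *\<^sub>R A + sin (k * s) *\<^sub>R B)"
      unfolding P_def by blast
  next
    fix f assume "P f"
    then obtain A B where f: "f = (\<lambda>s. cos (k * s) *\<^sub>R A + sin (k * s) *\<^sub>R B)"
      unfolding P_def by blast
    define f' where "f' s h = cos (k * s) *\<^sub>R ((h * k) *\<^sub>R B) + sin (k * s) *\<^sub>R ((- h * k) *\<^sub>R A)"
      for s h
    have "(f has_derivative f' s) (at s)" for s
      unfolding f f'_def
      by (auto intro!: derivative_eq_intros simp: algebra_simps)
    moreover have "P (\<lambda>s. f' s h)" for h
      unfolding P_def f'_def by blast
    ultimately show "\<exists>f'. \<forall>x. (f has_derivative f' x) (at x) \<and> (\<forall>v. P (\<lambda>x. f' x v))"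
      by blast
  qed
qed

lemma has_derivative_vec_lambda:
  fixes f :: "'a::real_normed_vector \<Rightarrow> 'n::finite \<Rightarrow> 'b::euclidean_space"
  assumes "\<And>i. ((\<lambda>x. f x i) has_derivative (\<lambda>h. f' h i)) (at x within S)"
  shows "((\<lambda>x. \<chi> i. f x i) has_derivative (\<lambda>h. \<chi> i. f' h i)) (at x within S)"
proof -
  have *: "(\<lambda>x. \<chi> i. g x i) = (\<lambda>x. \<Sum>i\<in>UNIV. axis i (g x i))" for g :: "'a \<Rightarrow> 'n \<Rightarrow> 'b"
    by (simp add: fun_eq_iff vec_eq_iff axis_def if_distrib[of "\<lambda>u. u $ _"] cong: if_cong)
  have ax: "bounded_linear (\<lambda>u::'b. axis i u)" for i :: 'n
    by (rule linear_conv_bounded_linear[THEN iffD1], rule linearI)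
       (auto simp: vec_eq_iff axis_def)
  show ?thesis
    unfolding * by (intro has_derivative_sum bounded_linear.has_derivative[OF ax] assms)
qed

lemma smooth_on_torus_line:
  fixes t :: "'n::finite \<Rightarrow> real" and c :: "'n \<Rightarrow> complex"
  shows "smooth_on U (\<lambda>s::real. \<chi> i. c i * cis (t i * s))"
proof -
  define P :: "(real \<Rightarrow> complex ^ 'n) \<Rightarrow> bool" where
    "P f \<longleftrightarrow> (\<exists>c. f = (\<lambda>s. \<chi> i. c i * cis (t i * s)))" for f
  show ?thesis
  proof (rule smooth_on_if_derivatives_closed[where P = P])
    show "P (\<lambda>s. \<chi> i. c i * cis (t i * s))"
      unfolding P_def by blast
  next
    fix f assume "P f"
    then obtain c where f: "f = (\<lambda>s. \<chi> i. c i * cis (t i * s))"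
      unfolding P_def by blast
    define f' :: "real \<Rightarrow> real \<Rightarrow> complex ^ 'n"
      where "f' s h = (\<chi> i. (of_real (h * t i) * \<i> * c i) * cis (t i * s))" for s h
    have "(f has_derivative f' s) (at s)" for s
      unfolding f f'_def
      by (rule has_derivative_vec_lambda)
         (auto intro!: derivative_eq_intros simp: algebra_simps scaleR_conv_of_real)
    moreover have "P (\<lambda>s. f' s h)" for h
      unfolding P_def f'_def by (rule exI, rule refl)
    ultimately show "\<exists>f'. \<forall>x. (f has_derivative f' x) (at x) \<and> (\<forall>v. P (\<lambda>x. f' x v))"
      by blast
  qed
qed


section \<open>Differentiation along a submanifold\<close>

text \<open>
  A linear map that is a derivative of \<open>f\<close> within a lower-dimensional \<open>M\<close> is not unique, but its
  value at the velocity of a curve in \<open>M\<close> is forced by the chain rule.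
\<close>

lemma derivative_within_along_curve:
  assumes f: "(f has_derivative f') (at p within M)"
    and \<gamma>: "(\<gamma> has_vector_derivative v) (at (0::real))" "\<gamma> ` {-\<epsilon><..<\<epsilon>} \<subseteq> M" "\<gamma> 0 = p" "0 < \<epsilon>"
  shows "((\<lambda>s. f (\<gamma> s)) has_vector_derivative f' v) (at 0)"
proof -
  let ?I = "{-\<epsilon><..<\<epsilon>}"
  have "(\<gamma> has_derivative (\<lambda>h. h *\<^sub>R v)) (at 0 within ?I)"
    using \<gamma>(1) unfolding has_vector_derivative_def by (rule has_derivative_at_withinI)
  moreover have "(f has_derivative f') (at (\<gamma> 0) within \<gamma> ` ?I)"
    using f \<gamma>(2,3) has_derivative_subset by blast
  ultimately have "((\<lambda>s. f (\<gamma> s)) has_derivative (\<lambda>h. f' (h *\<^sub>R v))) (at 0 within ?I)"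
    using has_derivative_in_compose by blast
  moreover have "at (0::real) within ?I = at 0"
    using \<gamma>(4) by (intro at_within_open) auto
  moreover have "f' (h *\<^sub>R v) = h *\<^sub>R f' v" for h
    using f by (simp add: has_derivative_def bounded_linear.linear linear_cmul)
  ultimately show ?thesis
    by (simp add: has_vector_derivative_def)
qed

lemma tangent_derivative_unique:
  assumes "(f has_derivative f') (at p within M)" "(f has_derivative f'') (at p within M)"
    and "v \<in> tangent_space M p"
  shows "f' v = f'' v"
proof -
  obtain \<gamma> \<epsilon> where "0 < \<epsilon>" "\<gamma> ` {-\<epsilon><..<\<epsilon>} \<subseteq> M" "\<gamma> 0 = p"
    "(\<gamma> has_vector_derivative v) (at (0::real))"
    using assms(3) unfolding tangent_space_def by blast
  then show ?thesis
    using derivative_within_along_curve assms(1,2) vector_derivative_unique_at by metis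
qed

lemma diff_eq_ambient_derivative:
  assumes "(F has_derivative F') (at p)" "\<And>q. q \<in> M \<Longrightarrow> f q = F q"
    and "p \<in> M" "v \<in> tangent_space M p"
  shows "diff M f p v = F' v"
proof -
  have f: "(f has_derivative F') (at p within M)"
    using has_derivative_transform[OF assms(3)] assms(2) has_derivative_at_withinI[OF assms(1)]
    by metis
  then have "(f has_derivative frechet_derivative f (at p within M)) (at p within M)"
    using differentiableI frechet_derivative_works by blast
  from tangent_derivative_unique[OF this f assms(4)] show ?thesis
    by (simp add: diff_def)
qed

lemma diff_id:
  assumes "p \<in> M" "v \<in> tangent_space M p"
  shows "diff M (\<lambda>x. x) p v = v"
  using diff_eq_ambient_derivative[OF has_derivative_ident _ assms] by simp

text \<open>
  This bounds tangent spaces from above: a tangent vector is killed by the derivative of each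
  defining equation.
\<close>

lemma derivative_of_constant_on:
  fixes F :: "'a::euclidean_space \<Rightarrow> 'b::euclidean_space"
  assumes "(F has_derivative F') (at p)" "\<And>q. q \<in> M \<Longrightarrow> F q = c"
    and "p \<in> M" "v \<in> tangent_space M p"
  shows "F' v = 0"
  using diff_eq_ambient_derivative[OF assms(1) _ assms(3,4), where f = F]
    diff_eq_ambient_derivative[OF has_derivative_const[of c] assms(2) assms(3,4)]
  by simp

lemma tangent_proj_eqI:
  assumes "subspace (tangent_space M p)" "w \<in> tangent_space M p"
    and "\<And>u. u \<in> tangent_space M p \<Longrightarrow> (v - w) \<bullet> u = 0"
  shows "tangent_proj M p v = w"
  unfolding tangent_proj_def
proof (rule the_equality)
  fix w' assume w': "w' \<in> tangent_space M p \<and> (\<forall>u\<in>tangent_space M p. (v - w') \<bullet> u = 0)"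
  have "w' - w \<in> tangent_space M p"
    using w' assms(1,2) subspace_diff by blast
  then have "(v - w) \<bullet> (w' - w) - (v - w') \<bullet> (w' - w) = 0"
    using w' assms(3) by simp
  then have "(w' - w) \<bullet> (w' - w) = 0"
    by (simp add: inner_diff_left)
  then show "w' = w"
    by simp
qed (use assms in blast)


section \<open>The unit sphere\<close>

abbreviation unit_sphere :: "'a::euclidean_space set" where "unit_sphere \<equiv> sphere 0 1"

lemma inner_self_sphere: "p \<in> unit_sphere \<Longrightarrow> p \<bullet> p = 1"
  by (simp add: dot_square_norm)

text \<open>
  Perpendicular vectors are tangent because they are velocities of great circles.
\<close>

lemma tangent_space_sphere:
  fixes p :: "'a::euclidean_space"
  assumes p: "p \<in> unit_sphere"
  shows "tangent_space unit_sphere p = {v. v \<bullet> p = 0}"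
proof (intro set_eqI iffI CollectI; (drule CollectD)?)
  fix v assume v: "v \<in> tangent_space unit_sphere p"
  have "((\<lambda>x. x \<bullet> x) has_derivative (\<lambda>h. p \<bullet> h + h \<bullet> p)) (at p)"
    by (auto intro!: derivative_eq_intros)
  from derivative_of_constant_on[OF this inner_self_sphere p v]
  show "v \<bullet> p = 0"
    by (simp add: inner_commute)
next
  fix v assume v: "v \<bullet> p = 0"
  \<comment> \<open>For \<open>v = 0\<close> both \<open>k\<close> and \<open>u\<close> are zero, and \<open>\<gamma>\<close> is the constant curve.\<close>
  define k where "k = norm v"
  define u where "u = v /\<^sub>R k"
  define \<gamma> where "\<gamma> s = cos (k * s) *\<^sub>R p + sin (k * s) *\<^sub>R u" for s
  have "norm (\<gamma> s) = 1" for s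
  proof (cases "k = 0")
    case True
    then show ?thesis using p by (simp add: \<gamma>_def)
  next
    case False
    have "u \<bullet> u = 1"
      using False by (simp add: u_def k_def dot_square_norm power2_eq_square)
    moreover have "u \<bullet> p = 0"
      using v by (simp add: u_def)
    ultimately have "\<gamma> s \<bullet> \<gamma> s = (cos (k * s))\<^sup>2 + (sin (k * s))\<^sup>2"
      using inner_self_sphere[OF p]
      by (simp add: \<gamma>_def inner_add_left inner_add_right inner_commute[of p u] power2_eq_square)
    then show ?thesis
      by (simp add: norm_eq_sqrt_inner)
  qed
  moreover have "smooth_on {-1<..<1} \<gamma>"
    unfolding \<gamma>_def by (rule smooth_on_circle)
  moreover have "(\<gamma> has_vector_derivative v) (at 0)"
    unfolding has_vector_derivative_def \<gamma>_def
    by (cases "k = 0") (auto intro!: derivative_eq_intros simp: u_def k_def)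
  ultimately show "v \<in> tangent_space unit_sphere p"
    unfolding tangent_space_def
    by (intro CollectI exI[of _ \<gamma>] exI[of _ 1]) (auto simp: \<gamma>_def)
qed

lemma tangent_proj_sphere:
  assumes "p \<in> unit_sphere"
  shows "tangent_proj unit_sphere p v = v - (v \<bullet> p) *\<^sub>R p"
  by (rule tangent_proj_eqI)
     (use assms inner_self_sphere[OF assms] in
       \<open>auto simp: tangent_space_sphere subspace_def inner_add_left inner_add_right
         inner_diff_left inner_diff_right inner_commute\<close>)

text \<open>
  The submersion \<open>x \<bullet> x - 1\<close> is scalar; it is placed on a line of the ambient space, which serves as
  the common target.
\<close>

lemma embedded_submanifold_sphere: "embedded_submanifold (unit_sphere :: 'a::euclidean_space set)"
proof -
  obtain b :: 'a where b: "b \<in> Basis"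
    using nonempty_Basis by blast
  define F where "F x = (x \<bullet> x) *\<^sub>R b + 0 + - b" for x :: 'a
  have bil: "bounded_bilinear (\<lambda>x y :: 'a. (x \<bullet> y) *\<^sub>R b)"
    unfolding bilinear_conv_bounded_bilinear[symmetric] bilinear_def
    by (auto intro!: linearI simp: inner_add_left inner_add_right scaleR_add_left)
  have smooth: "smooth_on UNIV F"
    unfolding F_def by (rule smooth_on_quadratic[OF bil bounded_linear_zero])
  have "(F has_derivative (\<lambda>h. (x \<bullet> h + h \<bullet> x) *\<^sub>R b)) (at x)" for x
    unfolding F_def by (auto intro!: derivative_eq_intros)
  from frechet_derivative_at[OF this, symmetric]
  have F': "frechet_derivative F (at x) = (\<lambda>h. (2 * (h \<bullet> x)) *\<^sub>R b)" for x
    by (simp add: inner_commute)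
  have F_eq: "F x = (x \<bullet> x - 1) *\<^sub>R b" for x
    by (simp add: F_def scaleR_left_diff_distrib)
  have zero: "unit_sphere = {x. F x = 0}"
    using b by (auto simp: F_eq norm_eq_1)
  have range: "range (frechet_derivative F (at x)) = range (\<lambda>t. t *\<^sub>R b)" if "x \<in> unit_sphere" for x
  proof (intro set_eqI iffI)
    fix w assume "w \<in> range (\<lambda>t. t *\<^sub>R b)"
    then obtain t where "w = t *\<^sub>R b"
      by blast
    then have "w = frechet_derivative F (at x) ((t / 2) *\<^sub>R x)"
      using inner_self_sphere[OF that] by (simp add: F')
    then show "w \<in> range (frechet_derivative F (at x))"
      by blast
  qed (auto simp: F')
  have "subspace (range (\<lambda>t. t *\<^sub>R b))"
    by (intro subspace_UNIV linear_subspace_image bounded_linear.linear bounded_linear_scaleR_left)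
  moreover have "F ` UNIV \<subseteq> range (\<lambda>t. t *\<^sub>R b)"
    by (auto simp: F_eq)
  ultimately show ?thesis
    unfolding embedded_submanifold_def
    by (intro exI[of _ "range (\<lambda>t. t *\<^sub>R b)"] conjI ballI exI[of _ UNIV] exI[of _ F])
       (use smooth zero range in auto)
qed

text \<open>
  The curvature differentiates this field once more, so its values are needed around a point and
  not only at those points where \<open>y\<close> and \<open>z\<close> are tangent.
\<close>

lemma sphere_levi_civita_extend:
  assumes q: "q \<in> unit_sphere"
  shows "levi_civita unit_sphere (extend unit_sphere y) (extend unit_sphere z) q
    = - (z \<bullet> q) *\<^sub>R (y - (y \<bullet> q) *\<^sub>R q)"
proof -
  define u where "u = y - (y \<bullet> q) *\<^sub>R q"
  have u: "extend unit_sphere y q = u" "u \<bullet> q = 0"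
    using inner_self_sphere[OF q] by (simp_all add: u_def extend_def tangent_proj_sphere[OF q] inner_diff_left)
  have "((\<lambda>q. z - (z \<bullet> q) *\<^sub>R q) has_derivative (\<lambda>h. - ((z \<bullet> h) *\<^sub>R q) - (z \<bullet> q) *\<^sub>R h)) (at q)"
    by (auto intro!: derivative_eq_intros)
  from diff_eq_ambient_derivative[OF this, of unit_sphere "extend unit_sphere z" u]
  have "diff unit_sphere (extend unit_sphere z) q u = - ((z \<bullet> u) *\<^sub>R q) - (z \<bullet> q) *\<^sub>R u"
    using q u by (simp add: extend_def tangent_proj_sphere tangent_space_sphere)
  then show ?thesis
    using inner_self_sphere[OF q] u
    by (simp add: nabla_def tangent_proj_sphere[OF q] inner_diff_left flip: u_def)
qed

text \<open>
  At a point where \<open>x\<close>, \<open>y\<close> and \<open>z\<close> are tangent, the covariant derivative of the extension of \<open>y\<close>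
  along that of \<open>x\<close> vanishes, and so does the bracket.  Only the second derivatives remain, and these
  come from differentiating the factor \<open>z \<bullet> q\<close> in \<open>sphere_levi_civita_extend\<close>.
\<close>

lemma curvature_sphere:
  assumes p: "p \<in> unit_sphere" and t: "x \<bullet> p = 0" "y \<bullet> p = 0" "z \<bullet> p = 0"
  shows "curvature unit_sphere p x y z = (y \<bullet> z) *\<^sub>R x - (x \<bullet> z) *\<^sub>R y"
proof -
  have ext: "extend unit_sphere v p = v" if "v \<bullet> p = 0" for v
    using that p by (simp add: extend_def tangent_proj_sphere)
  have D: "diff unit_sphere (extend unit_sphere w) p v = - (v \<bullet> w) *\<^sub>R p" if "v \<bullet> p = 0" "w \<bullet> p = 0" for v w
  proof -
    have "((\<lambda>q. w - (w \<bullet> q) *\<^sub>R q) has_derivative (\<lambda>h. - ((w \<bullet> h) *\<^sub>R p) - (w \<bullet> p) *\<^sub>R h)) (at p)"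
      by (auto intro!: derivative_eq_intros)
    from diff_eq_ambient_derivative[OF this, of unit_sphere "extend unit_sphere w" v]
    show ?thesis
      using p that by (simp add: extend_def tangent_proj_sphere tangent_space_sphere inner_commute)
  qed
  have second: "levi_civita unit_sphere (extend unit_sphere v)
      (levi_civita unit_sphere (extend unit_sphere w) (extend unit_sphere z)) p
      = - (z \<bullet> v) *\<^sub>R w" if "v \<bullet> p = 0" "w \<bullet> p = 0" for v w
  proof -
    \<comment> \<open>The other terms of the product rule contain \<open>z \<bullet> p\<close> or \<open>w \<bullet> p\<close>, which are zero.\<close>
    have "((\<lambda>q. - (z \<bullet> q) *\<^sub>R (w - (w \<bullet> q) *\<^sub>R q)) has_derivative (\<lambda>h. - (z \<bullet> h) *\<^sub>R w)) (at p)"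
      by (rule derivative_eq_intros refl)+ (use that t in \<open>simp add: inner_commute\<close>)
    from diff_eq_ambient_derivative[OF this, of unit_sphere
        "levi_civita unit_sphere (extend unit_sphere w) (extend unit_sphere z)" v]
    show ?thesis
      using that p ext by (simp add: nabla_def[of _ _ _ _ "nabla _ _ _ _ _"] sphere_levi_civita_extend
          tangent_space_sphere tangent_proj_sphere)
  qed
  have bracket: "lie_bracket unit_sphere (extend unit_sphere x) (extend unit_sphere y) p = 0"
    using t by (simp add: lie_bracket_def ext D inner_commute)
  have "levi_civita unit_sphere (lie_bracket unit_sphere (extend unit_sphere x) (extend unit_sphere y))
      (extend unit_sphere z) p = 0"
    using D[of 0 z] t p by (simp add: nabla_def bracket tangent_proj_sphere)
  then show ?thesis
    using t by (simp add: curvature_def curvature_op_def second inner_commute)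
qed


section \<open>The torus\<close>

definition cscale :: "('n::finite \<Rightarrow> real) \<Rightarrow> complex ^ 'n \<Rightarrow> complex ^ 'n" where
  "cscale c z = (\<chi> i. c i *\<^sub>R z $ i)"

lemma cscale_nth [simp]: "cscale c z $ i = c i *\<^sub>R z $ i"
  by (simp add: cscale_def)

lemma cscale_0 [simp]: "cscale c 0 = 0"
  by (simp add: vec_eq_iff)

lemma bounded_linear_cscale: "bounded_linear (cscale c)"
  by (simp add: linear_conv_bounded_linear[symmetric] linear_iff vec_eq_iff scaleR_right_distrib)

lemma orthonormal_basis_expansion:
  fixes x :: "'a::euclidean_space"
  assumes "orthonormal_basis T B" "x \<in> T"
  shows "(\<Sum>e\<in>B. (x \<bullet> e) *\<^sub>R e) = x"
proof -
  have B: "span B = T" "pairwise orthogonal B" "\<And>e. e \<in> B \<Longrightarrow> norm e = 1" "finite B"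
    using assms(1) pairwise_orthogonal_imp_finite unfolding orthonormal_basis_def by auto
  define r where "r = x - (\<Sum>e\<in>B. (x \<bullet> e) *\<^sub>R e)"
  have "r \<in> span B"
    unfolding r_def using assms(2) B(1)
    by (auto intro: span_diff span_sum span_scale span_base)
  have "orthogonal r b" if b: "b \<in> B" for b
  proof -
    have "(\<Sum>e\<in>B. (x \<bullet> e) *\<^sub>R e) \<bullet> b = (\<Sum>e\<in>B. if e = b then x \<bullet> b else 0)"
      unfolding inner_sum_left
      using B(2,3) b
      by (intro sum.cong) (auto simp: dot_square_norm pairwise_def orthogonal_def)
    then show ?thesis
      using B(4) b by (simp add: r_def orthogonal_def inner_diff_left)
  qed
  then have "orthogonal r r"
    using orthogonal_to_span[OF \<open>r \<in> span B\<close>] by blast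
  then show ?thesis
    by (simp add: r_def orthogonal_self)
qed

lemma torus_component_inner_self: "z \<in> torus a \<Longrightarrow> z $ i \<bullet> z $ i = (a i)\<^sup>2"
  by (simp add: torus_def dot_square_norm)

context
  fixes a :: "'n::finite \<Rightarrow> real"
  assumes a: "\<And>i. a i > 0"
begin

text \<open>
  The lower bound uses the curves that rotate each coordinate at its own constant speed: a complex
  number perpendicular to \<open>z\<^sub>i\<close> is a real multiple of \<open>\<i> z\<^sub>i\<close>.
\<close>

lemma tangent_space_torus:
  assumes z: "z \<in> torus a"
  shows "tangent_space (torus a) z = {v. \<forall>i. v $ i \<bullet> z $ i = 0}"
proof (intro set_eqI iffI CollectI allI; (drule CollectD)?)
  fix v i assume v: "v \<in> tangent_space (torus a) z"
  have "((\<lambda>x. x $ i \<bullet> x $ i) has_derivative (\<lambda>h. z $ i \<bullet> h $ i + h $ i \<bullet> z $ i)) (at z)"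
    by (auto intro!: derivative_eq_intros bounded_linear.has_derivative[OF bounded_linear_vec_nth])
  from derivative_of_constant_on[OF this torus_component_inner_self z v]
  show "v $ i \<bullet> z $ i = 0"
    by (simp add: inner_commute)
next
  fix v assume v: "\<forall>i. v $ i \<bullet> z $ i = 0"
  \<comment> \<open>The angular speed in the \<open>i\<close>th coordinate, found by solving \<open>v\<^sub>i = \<i> t\<^sub>i z\<^sub>i\<close>.\<close>
  define t where "t i = Im (v $ i * cnj (z $ i)) / (a i)\<^sup>2" for i
  define \<gamma> where "\<gamma> s = (\<chi> i. z $ i * cis (t i * s))" for s
  have v_eq: "v $ i = of_real (t i) * \<i> * z $ i" for i
  proof -
    have "z $ i * cnj (z $ i) = of_real ((a i)\<^sup>2)"
      using z by (simp add: torus_def flip: complex_norm_square)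
    moreover have "v $ i * cnj (z $ i) = \<i> * of_real (t i * (a i)\<^sup>2)"
      using v a[of i] by (auto simp: t_def complex_eq_iff inner_complex_def)
    ultimately have "of_real ((a i)\<^sup>2) * v $ i = of_real ((a i)\<^sup>2) * (of_real (t i) * \<i> * z $ i)"
      by (metis (no_types, opaque_lifting) mult.assoc mult.commute of_real_mult)
    then show ?thesis
      using a[of i] by simp
  qed
  have "\<gamma> s \<in> torus a" for s
    using z by (simp add: torus_def \<gamma>_def norm_mult)
  moreover have "smooth_on {-1<..<1} \<gamma>"
    unfolding \<gamma>_def by (rule smooth_on_torus_line)
  moreover have "(\<gamma> has_vector_derivative v) (at 0)"
  proof -
    have "(\<gamma> has_derivative (\<lambda>h. \<chi> i. h *\<^sub>R v $ i)) (at 0)"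
      unfolding \<gamma>_def
      by (rule has_derivative_vec_lambda)
         (auto intro!: derivative_eq_intros simp: v_eq scaleR_conv_of_real)
    moreover have "(\<chi> i. h *\<^sub>R v $ i) = h *\<^sub>R v" for h
      by (simp add: vec_eq_iff)
    ultimately show ?thesis
      by (simp add: has_vector_derivative_def)
  qed
  ultimately show "v \<in> tangent_space (torus a) z"
    unfolding tangent_space_def
    by (intro CollectI exI[of _ \<gamma>] exI[of _ 1]) (auto simp: \<gamma>_def)
qed

lemma subspace_tangent_torus:
  assumes "z \<in> torus a"
  shows "subspace (tangent_space (torus a) z)"
  by (simp add: tangent_space_torus[OF assms] subspace_def inner_add_left)

lemma tangent_proj_torus:
  assumes z: "z \<in> torus a"
  shows "tangent_proj (torus a) z v = (\<chi> i. v $ i - ((v $ i \<bullet> z $ i) / (a i)\<^sup>2) *\<^sub>R z $ i)"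
proof (rule tangent_proj_eqI[OF subspace_tangent_torus[OF z]])
  have "a i \<noteq> 0" for i
    using a[of i] by simp
  then show "(\<chi> i. v $ i - ((v $ i \<bullet> z $ i) / (a i)\<^sup>2) *\<^sub>R z $ i) \<in> tangent_space (torus a) z"
    using torus_component_inner_self[OF z]
    by (simp add: tangent_space_torus[OF z] inner_diff_left)
next
  fix u assume "u \<in> tangent_space (torus a) z"
  then show "(v - (\<chi> i. v $ i - ((v $ i \<bullet> z $ i) / (a i)\<^sup>2) *\<^sub>R z $ i)) \<bullet> u = 0"
    by (simp add: tangent_space_torus[OF z] inner_vec_def inner_commute)
qed

text \<open>
  The defining equations take one real value per coordinate; the common target of the submersion is
  the real subspace of the ambient complex space.
\<close>

lemma embedded_submanifold_torus:
  shows "embedded_submanifold (torus a)"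
proof -
  define L :: "(complex ^ 'n) set" where "L = {v. \<forall>i. Im (v $ i) = 0}"
  define F :: "complex ^ 'n \<Rightarrow> complex ^ 'n"
    where "F x = (\<chi> i. of_real (x $ i \<bullet> x $ i)) + 0 + (\<chi> i. - of_real ((a i)\<^sup>2))" for x
  have bil: "bounded_bilinear (\<lambda>x y :: complex ^ 'n. (\<chi> i. of_real (x $ i \<bullet> y $ i)) :: complex ^ 'n)"
    unfolding bilinear_conv_bounded_bilinear[symmetric] bilinear_def
    by (auto intro!: linearI simp: vec_eq_iff complex_eq_iff inner_add_left inner_add_right)
  have smooth: "smooth_on UNIV F"
    unfolding F_def by (rule smooth_on_quadratic[OF bil bounded_linear_zero])
  have "(F has_derivative (\<lambda>h. (\<chi> i. of_real (x $ i \<bullet> h $ i)) + (\<chi> i. of_real (h $ i \<bullet> x $ i)) + 0 + 0))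
      (at x)" for x
    unfolding F_def
    by (intro has_derivative_add has_derivative_const bounded_bilinear.FDERIV[OF bil] has_derivative_ident)
  note F' = frechet_derivative_at[OF this, symmetric]
  have zero: "torus a = {x. F x = 0}"
  proof -
    have "norm w = a i \<longleftrightarrow> w \<bullet> w = (a i)\<^sup>2" for w :: complex and i
      using a[of i] by (simp add: dot_square_norm power2_eq_iff_nonneg)
    then show ?thesis
      by (auto simp: torus_def F_def vec_eq_iff simp flip: of_real_diff of_real_power)
  qed
  have range: "range (frechet_derivative F (at x)) = L" if x: "x \<in> torus a" for x
  proof (intro set_eqI iffI)
    fix w assume "w \<in> L"
    then have "w = frechet_derivative F (at x) (\<chi> i. (Re (w $ i) / (2 * (a i)\<^sup>2)) *\<^sub>R x $ i)"
      using a[THEN less_imp_neq, symmetric] torus_component_inner_self[OF x]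
      by (simp add: F' L_def vec_eq_iff complex_eq_iff)
    then show "w \<in> range (frechet_derivative F (at x))"
      by blast
  qed (auto simp: F' L_def)
  have "subspace L"
    by (simp add: L_def subspace_def)
  moreover have "F ` UNIV \<subseteq> L"
    by (auto simp: F_def L_def)
  ultimately show ?thesis
    unfolding embedded_submanifold_def
    by (intro exI[of _ L] conjI ballI exI[of _ UNIV] exI[of _ F])
       (use smooth zero range in auto)
qed

text \<open>
  The projection of a tangent vector to the \<open>i\<close>th coordinate is its component along the unit tangent
  vector \<open>E\<close> of the \<open>i\<close>th circle, so the sum is \<open>\<bar>E\<bar>\<^sup>2\<close> by Parseval's identity.
\<close>

lemma sum_component_squares_orthonormal:
  assumes z: "z \<in> torus a"
    and B: "orthonormal_basis (tangent_space (torus a) z) B"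
  shows "(\<Sum>e\<in>B. e $ i \<bullet> e $ i) = 1"
proof -
  define E :: "complex ^ 'n" where "E = axis i (\<i> * z $ i / of_real (a i))"
  have finB: "finite B"
    using B pairwise_orthogonal_imp_finite unfolding orthonormal_basis_def by blast
  have "E \<in> tangent_space (torus a) z"
    by (simp add: tangent_space_torus[OF z] E_def axis_def inner_complex_def)
  then have E: "(\<Sum>e\<in>B. (E \<bullet> e) *\<^sub>R e) = E"
    using B orthonormal_basis_expansion by blast
  have sq: "e $ i \<bullet> e $ i = (E \<bullet> e)\<^sup>2" if "e \<in> B" for e
  proof -
    have "e $ i \<bullet> z $ i = 0"
      using that B by (auto simp: orthonormal_basis_def tangent_space_torus[OF z])
    then have 0: "Re (e $ i) * Re (z $ i) + Im (e $ i) * Im (z $ i) = 0"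
      by (simp add: inner_complex_def)
    have 1: "(Re (z $ i))\<^sup>2 + (Im (z $ i))\<^sup>2 = (a i)\<^sup>2"
      using z by (simp add: torus_def flip: cmod_power2)
    have "a i * (E \<bullet> e) = Re (z $ i) * Im (e $ i) - Im (z $ i) * Re (e $ i)"
      using a[of i] by (simp add: E_def inner_axis' inner_complex_def field_simps)
    then have "(a i)\<^sup>2 * (E \<bullet> e)\<^sup>2 = (Re (z $ i) * Im (e $ i) - Im (z $ i) * Re (e $ i))\<^sup>2"
      by (metis power_mult_distrib)
    also have "\<dots> = (a i)\<^sup>2 * (e $ i \<bullet> e $ i)"
      unfolding 1[symmetric] inner_complex_def using 0 by algebra
    finally show ?thesis
      using a[of i] by simp
  qed
  have "(\<Sum>e\<in>B. e $ i \<bullet> e $ i) = (\<Sum>e\<in>B. (E \<bullet> e) *\<^sub>R e) \<bullet> E"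
    by (simp add: sq inner_sum_left power2_eq_square inner_commute[of E] cong: sum.cong)
  also have "\<dots> = 1"
    unfolding E unfolding E_def inner_axis_axis using a[of i] z
    by (simp add: dot_square_norm norm_mult norm_divide torus_def)
  finally show ?thesis .
qed

text \<open>
  The trace is taken over an unspecified orthonormal basis.  For a form that is linear in the squared
  lengths of the coordinates, \<open>sum_component_squares_orthonormal\<close> gives the trace without a basis:
  \<open>1\<close> is the vector with all entries \<open>1\<close>.
\<close>

lemma trace_on_tangent_torus:
  fixes L :: "real ^ 'n \<Rightarrow> complex ^ 'n"
  assumes z: "z \<in> torus a" and L: "linear L"
    and b: "\<And>v. v \<in> tangent_space (torus a) z \<Longrightarrow> b v v = L (\<chi> i. v $ i \<bullet> v $ i)"
  shows "trace_on (tangent_space (torus a) z) b = L 1"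
proof -
  let ?T = "tangent_space (torus a) z"
  define B where "B = (SOME B. orthonormal_basis ?T B)"
  have "\<exists>B. orthonormal_basis ?T B"
    using orthonormal_basis_subspace[OF subspace_tangent_torus[OF z]]
    unfolding orthonormal_basis_def by metis
  then have B: "orthonormal_basis ?T B"
    unfolding B_def by (rule someI_ex)
  then have "trace_on ?T b = (\<Sum>e\<in>B. L (\<chi> i. e $ i \<bullet> e $ i))"
    unfolding trace_on_def B_def[symmetric]
    by (intro sum.cong refl b) (auto simp: orthonormal_basis_def)
  also have "\<dots> = L (\<Sum>e\<in>B. \<chi> i. e $ i \<bullet> e $ i)"
    by (simp add: linear_sum[OF L])
  also have "(\<Sum>e\<in>B. \<chi> i. e $ i \<bullet> e $ i) = 1"
    by (simp add: vec_eq_iff sum_component_squares_orthonormal[OF z B])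
  finally show ?thesis .
qed



lemma extend_torus:
  assumes z: "z \<in> torus a"
  shows "extend (torus a) v z = (\<chi> i. v $ i - ((v $ i \<bullet> z $ i) / (a i)\<^sup>2) *\<^sub>R z $ i)"
  by (simp add: extend_def tangent_proj_torus[OF z])

lemma extend_torus_in_tangent:
  assumes z: "z \<in> torus a"
  shows "extend (torus a) v z \<in> tangent_space (torus a) z"
  using a[THEN less_imp_neq, symmetric] torus_component_inner_self[OF z]
  by (simp add: extend_torus[OF z] tangent_space_torus[OF z] inner_diff_left)

lemma extend_torus_tangent:
  assumes z: "z \<in> torus a" and v: "v \<in> tangent_space (torus a) z"
  shows "extend (torus a) v z = v"
  using v by (simp add: extend_torus[OF z] tangent_space_torus[OF z] vec_eq_iff)

text \<open>
  Differentiating \<open>c\<^sub>i (w\<^sub>i - (w\<^sub>i \<bullet> q\<^sub>i / a\<^sub>i\<^sup>2) q\<^sub>i)\<close> at \<open>z\<close>, the term with \<open>w\<^sub>i \<bullet> z\<^sub>i\<close> drops out since \<open>w\<close>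
  is tangent there.  With \<open>c = 1\<close> this is the derivative of a tangent field; general \<open>c\<close> is needed for
  second covariant derivatives of diagonal fields.
\<close>

lemma diff_cscale_extend_torus:
  assumes z: "z \<in> torus a"
    and v: "v \<in> tangent_space (torus a) z" and w: "w \<in> tangent_space (torus a) z"
    and V: "\<And>q. q \<in> torus a \<Longrightarrow> V q = cscale c (extend (torus a) w q)"
  shows "diff (torus a) V z v = cscale (\<lambda>i. - (c i * (w $ i \<bullet> v $ i) / (a i)\<^sup>2)) z"
proof -
  let ?Y = "\<lambda>q. \<chi> i. w $ i - ((w $ i \<bullet> q $ i) / (a i)\<^sup>2) *\<^sub>R q $ i"
  have "(?Y has_derivative (\<lambda>h. \<chi> i. - ((w $ i \<bullet> h $ i) / (a i)\<^sup>2) *\<^sub>R z $ i)) (at z)"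
  proof (rule has_derivative_vec_lambda)
    fix i
    have "w $ i \<bullet> z $ i = 0"
      using w by (simp add: tangent_space_torus[OF z])
    moreover have "((\<lambda>q. w $ i - (inverse ((a i)\<^sup>2) * (w $ i \<bullet> q $ i)) *\<^sub>R q $ i) has_derivative
        (\<lambda>h. - ((inverse ((a i)\<^sup>2) * (w $ i \<bullet> h $ i)) *\<^sub>R z $ i)
          - (inverse ((a i)\<^sup>2) * (w $ i \<bullet> z $ i)) *\<^sub>R h $ i)) (at z)"
      by (auto intro!: derivative_eq_intros bounded_linear.has_derivative[OF bounded_linear_vec_nth])
    ultimately show "((\<lambda>q. w $ i - ((w $ i \<bullet> q $ i) / (a i)\<^sup>2) *\<^sub>R q $ i) has_derivative
        (\<lambda>h. - ((w $ i \<bullet> h $ i) / (a i)\<^sup>2) *\<^sub>R z $ i)) (at z)"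
      by (simp add: divide_inverse mult.commute)
  qed
  from bounded_linear.has_derivative[OF bounded_linear_cscale this]
  have "((\<lambda>q. cscale c (?Y q)) has_derivative
      (\<lambda>h. cscale c (\<chi> i. - ((w $ i \<bullet> h $ i) / (a i)\<^sup>2) *\<^sub>R z $ i))) (at z)" .
  from diff_eq_ambient_derivative[OF this, of "torus a" V v] show ?thesis
    using V z v by (simp add: extend_def tangent_proj_torus vec_eq_iff)
qed

lemma diff_extend_torus:
  assumes z: "z \<in> torus a"
    and v: "v \<in> tangent_space (torus a) z" and w: "w \<in> tangent_space (torus a) z"
  shows "diff (torus a) (extend (torus a) w) z v = cscale (\<lambda>i. - ((w $ i \<bullet> v $ i) / (a i)\<^sup>2)) z"
  using diff_cscale_extend_torus[OF z v w, of "extend (torus a) w" "\<lambda>_. 1"]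
  by (simp add: cscale_def)

text \<open>
  The derivative of a tangential extension is normal to the torus.  As a consequence the correction
  terms in the second fundamental form and in the second covariant derivative vanish.
\<close>

lemma levi_civita_torus_extend:
  assumes z: "z \<in> torus a"
    and v: "v \<in> tangent_space (torus a) z" and w: "w \<in> tangent_space (torus a) z"
  shows "levi_civita (torus a) (extend (torus a) v) (extend (torus a) w) z = 0"
  using a[THEN less_imp_neq, symmetric] torus_component_inner_self[OF z]
  by (simp add: nabla_def extend_torus_tangent[OF z v] diff_extend_torus[OF z v w] tangent_proj_torus[OF z]
      vec_eq_iff)


section \<open>The bitension field of the torus in the sphere\<close>

context
  assumes unit: "(\<Sum>i\<in>UNIV. (a i)\<^sup>2) = 1"
begin

lemma torus_in_sphere:
  assumes z: "z \<in> torus a"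
  shows "z \<in> unit_sphere"
proof -
  have "z \<bullet> z = 1"
    using unit by (simp add: inner_vec_def torus_component_inner_self[OF z])
  then show ?thesis
    by (simp add: norm_eq_1)
qed

lemma tangent_proj_sphere_cscale:
  assumes z: "z \<in> torus a"
  shows "tangent_proj unit_sphere z (cscale c z) = cscale (\<lambda>i. c i - (\<Sum>j\<in>UNIV. c j * (a j)\<^sup>2)) z"
proof -
  have "cscale c z \<bullet> z = (\<Sum>j\<in>UNIV. c j * (a j)\<^sup>2)"
    by (simp add: inner_vec_def torus_component_inner_self[OF z])
  then show ?thesis
    by (simp add: tangent_proj_sphere[OF torus_in_sphere[OF z]] vec_eq_iff scaleR_left_diff_distrib)
qed

text \<open>
  The second fundamental form is the derivative \<open>- (\<bar>v\<^sub>i\<bar>\<^sup>2 / a\<^sub>i\<^sup>2) z\<^sub>i\<close>, projected to the sphere; the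
  projection adds \<open>\<bar>v\<bar>\<^sup>2 z\<close>.
\<close>

lemma tension_torus:
  assumes z: "z \<in> torus a"
  shows "tension (torus a) unit_sphere (\<lambda>x. x) z = cscale (\<lambda>i. real CARD('n) - 1 / (a i)\<^sup>2) z"
proof -
  let ?T = "tangent_space (torus a) z"
  define L :: "real ^ 'n \<Rightarrow> complex ^ 'n"
    where "L s = cscale (\<lambda>i. (\<Sum>j\<in>UNIV. s $ j) - s $ i / (a i)\<^sup>2) z" for s
  have "linear L"
    by (rule linearI)
       (simp_all add: L_def vec_eq_iff sum.distrib algebra_simps add_divide_distrib
         flip: sum_distrib_left)
  moreover have "nabla_d (torus a) unit_sphere (\<lambda>x. x) (extend (torus a) v) (extend (torus a) v) z
      = L (\<chi> i. v $ i \<bullet> v $ i)" if v: "v \<in> ?T" for v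
  proof -
    have "diff (torus a) (\<lambda>q. diff (torus a) (\<lambda>x. x) q (extend (torus a) v q)) z v
        = cscale (\<lambda>i. - (1 * (v $ i \<bullet> v $ i) / (a i)\<^sup>2)) z"
      by (rule diff_cscale_extend_torus[OF z v v])
         (simp add: diff_id extend_torus_in_tangent vec_eq_iff)
    moreover have "diff (torus a) (\<lambda>x. x) z 0 = 0"
      by (rule diff_id[OF z]) (simp add: tangent_space_torus[OF z])
    moreover have "(v $ i \<bullet> v $ i) / (a i)\<^sup>2 * (a i)\<^sup>2 = v $ i \<bullet> v $ i" for i
      using a[of i] by simp
    ultimately show ?thesis
      by (simp add: nabla_d_def levi_civita_torus_extend[OF z v v])
         (simp add: nabla_def extend_torus_tangent[OF z v] tangent_proj_sphere_cscale[OF z] L_def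
          sum_negf)
  qed
  ultimately have "tension (torus a) unit_sphere (\<lambda>x. x) z = L 1"
    unfolding tension_def by (rule trace_on_tangent_torus[OF z])
  then show ?thesis
    by (simp add: L_def)
qed

text \<open>
  For tangent \<open>x\<close> the vector \<open>(c\<^sub>i x\<^sub>i)\<^sub>i\<close> is perpendicular to \<open>z\<close> coordinate by coordinate, so the
  projection to the sphere does not change it.
\<close>

lemma nabla_cscale_torus:
  assumes z: "z \<in> torus a" and V: "\<And>q. q \<in> torus a \<Longrightarrow> V q = cscale c q"
    and X: "X z \<in> tangent_space (torus a) z"
  shows "nabla (torus a) unit_sphere (\<lambda>x. x) X V z = cscale c (X z)"
proof -
  have "diff (torus a) V z (X z) = cscale c (X z)"
    by (rule diff_eq_ambient_derivative[OF _ V z X])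
       (rule bounded_linear_imp_has_derivative[OF bounded_linear_cscale])
  moreover have "cscale c (X z) \<bullet> z = 0"
    using X by (simp add: inner_vec_def tangent_space_torus[OF z])
  ultimately show ?thesis
    by (simp add: nabla_def tangent_proj_sphere[OF torus_in_sphere[OF z]])
qed

lemma rough_laplacian_cscale_torus:
  assumes z: "z \<in> torus a" and V: "\<And>q. q \<in> torus a \<Longrightarrow> V q = cscale c q"
  shows "rough_laplacian (torus a) unit_sphere (\<lambda>x. x) V z
    = cscale (\<lambda>i. c i / (a i)\<^sup>2 - (\<Sum>j\<in>UNIV. c j)) z"
proof -
  let ?T = "tangent_space (torus a) z"
  define L :: "real ^ 'n \<Rightarrow> complex ^ 'n"
    where "L s = cscale (\<lambda>i. (\<Sum>j\<in>UNIV. c j * s $ j) - c i * s $ i / (a i)\<^sup>2) z" for s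
  have "linear L"
    by (rule linearI)
       (simp_all add: L_def vec_eq_iff sum.distrib algebra_simps add_divide_distrib
         flip: sum_distrib_left)
  moreover have "nabla2 (torus a) unit_sphere (\<lambda>x. x) (extend (torus a) v) (extend (torus a) v) V z
      = L (\<chi> i. v $ i \<bullet> v $ i)" if v: "v \<in> ?T" for v
  proof -
    have "diff (torus a) (nabla (torus a) unit_sphere (\<lambda>x. x) (extend (torus a) v) V) z v
        = cscale (\<lambda>i. - (c i * (v $ i \<bullet> v $ i) / (a i)\<^sup>2)) z"
      by (rule diff_cscale_extend_torus[OF z v v])
         (rule nabla_cscale_torus[OF _ V extend_torus_in_tangent])
    moreover have "c i * (v $ i \<bullet> v $ i) / (a i)\<^sup>2 * (a i)\<^sup>2 = c i * (v $ i \<bullet> v $ i)" for i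
      using a[of i] by simp
    ultimately have "nabla (torus a) unit_sphere (\<lambda>x. x) (extend (torus a) v)
        (nabla (torus a) unit_sphere (\<lambda>x. x) (extend (torus a) v) V) z = L (\<chi> i. v $ i \<bullet> v $ i)"
      by (simp add: nabla_def[of _ _ _ _ "nabla _ _ _ _ _"] extend_torus_tangent[OF z v]
          tangent_proj_sphere_cscale[OF z] L_def sum_negf)
    moreover have "nabla (torus a) unit_sphere (\<lambda>x. x)
        (levi_civita (torus a) (extend (torus a) v) (extend (torus a) v)) V z = 0"
      using nabla_cscale_torus[OF z V, of "levi_civita (torus a) (extend (torus a) v) (extend (torus a) v)"]
      by (simp add: levi_civita_torus_extend[OF z v v] tangent_space_torus[OF z])
    ultimately show ?thesis
      by (simp add: nabla2_def)
  qed
  ultimately have "rough_laplacian (torus a) unit_sphere (\<lambda>x. x) V z = - L 1"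
    unfolding rough_laplacian_def by (subst trace_on_tangent_torus[OF z]) auto
  then show ?thesis
    by (simp add: L_def vec_eq_iff algebra_simps)
qed

text \<open>
  Since \<open>\<Sum>\<^sub>i a\<^sub>i\<^sup>2 = 1\<close>, the tension field with coefficients \<open>c\<^sub>i = m - 1 / a\<^sub>i\<^sup>2\<close> is perpendicular to \<open>z\<close>,
  hence tangent to the sphere.  It is also perpendicular to the torus, so the
  curvature at \<open>(v, \<tau>, v)\<close> reduces to \<open>- \<bar>v\<bar>\<^sup>2 \<tau>\<close>.
\<close>

lemma bitension_torus:
  fixes m d :: real
  assumes z: "z \<in> torus a"
  defines "m \<equiv> real CARD('n)" and "d \<equiv> \<Sum>j\<in>UNIV. 1 / (a j)\<^sup>2"
  shows "bitension (torus a) unit_sphere (\<lambda>x. x) z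
    = cscale (\<lambda>i. 2 * m\<^sup>2 - d - 2 * m / (a i)\<^sup>2 + 1 / (a i) ^ 4) z"
proof -
  let ?T = "tangent_space (torus a) z"
  define c where "c i = m - 1 / (a i)\<^sup>2" for i
  have tension: "tension (torus a) unit_sphere (\<lambda>x. x) q = cscale c q" if "q \<in> torus a" for q
    unfolding c_def m_def by (rule tension_torus[OF that])
  have "(\<Sum>i\<in>UNIV. c i * (a i)\<^sup>2) = (\<Sum>i\<in>UNIV. m * (a i)\<^sup>2 - 1)"
    using a by (intro sum.cong refl) (simp add: c_def left_diff_distrib less_imp_neq[symmetric])
  also have "\<dots> = 0"
    using unit by (simp add: sum_subtractf m_def flip: sum_distrib_left)
  finally have cz: "cscale c z \<bullet> z = 0"
    by (simp add: inner_vec_def torus_component_inner_self[OF z])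
  define L :: "real ^ 'n \<Rightarrow> complex ^ 'n"
    where "L s = - (\<Sum>j\<in>UNIV. s $ j) *\<^sub>R cscale c z" for s
  have "linear L"
    by (rule linearI)
       (simp_all add: L_def sum.distrib scaleR_left_diff_distrib flip: sum_distrib_left)
  moreover have "curvature unit_sphere z (diff (torus a) (\<lambda>x. x) z v) (tension (torus a) unit_sphere (\<lambda>x. x) z)
      (diff (torus a) (\<lambda>x. x) z v) = L (\<chi> i. v $ i \<bullet> v $ i)" if v: "v \<in> ?T" for v
  proof -
    have "v \<bullet> z = 0" "cscale c z \<bullet> v = 0"
      using v by (simp_all add: inner_vec_def tangent_space_torus[OF z] inner_commute)
    then show ?thesis
      using cz v
      by (simp add: diff_id[OF z] tension[OF z] curvature_sphere[OF torus_in_sphere[OF z]] L_def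
          inner_vec_def[of v v])
  qed
  ultimately have "trace_on ?T (\<lambda>v w. curvature unit_sphere z (diff (torus a) (\<lambda>x. x) z v)
      (tension (torus a) unit_sphere (\<lambda>x. x) z) (diff (torus a) (\<lambda>x. x) z w)) = L 1"
    by (rule trace_on_tangent_torus[OF z])
  then have "bitension (torus a) unit_sphere (\<lambda>x. x) z
      = cscale (\<lambda>i. (\<Sum>j\<in>UNIV. c j) - c i / (a i)\<^sup>2 + m * c i) z"
    by (simp add: bitension_def rough_laplacian_cscale_torus[OF z tension] L_def vec_eq_iff
        m_def algebra_simps)
  moreover have "(\<Sum>j\<in>UNIV. c j) = m\<^sup>2 - d"
    by (simp add: c_def sum_subtractf d_def m_def power2_eq_square)
  moreover have "m\<^sup>2 - d - c i / (a i)\<^sup>2 + m * c i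
      = 2 * m\<^sup>2 - d - 2 * m / (a i)\<^sup>2 + 1 / (a i) ^ 4" for i
    using a[of i] by (simp add: c_def field_simps power2_eq_square power4_eq_xxxx)
  ultimately show ?thesis
    by simp
qed

end

end


section \<open>The criterion for biharmonicity\<close>

theorem theorem3:
  fixes n :: nat and a :: "'n::finite \<Rightarrow> real" and d :: real
  assumes "n \<ge> 1"
    and "CARD('n) = n + 1"
    and "\<And>i. a i > 0"
    and "(\<Sum>i\<in>UNIV. (a i)\<^sup>2) = 1"
    and "d = (\<Sum>j\<in>UNIV. 1 / (a j)\<^sup>2)"
  shows "biharmonic_submanifold (torus a) (sphere (0 :: complex ^ 'n) 1) \<longleftrightarrow>
    (\<forall>i. a i * d - 1 / (a i) ^ 3 = 2 * (real n + 1) * ((real n + 1) * a i - 1 / a i))"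
proof -
  let ?P = "\<lambda>i. 2 * (real n + 1)\<^sup>2 - d - 2 * (real n + 1) / (a i)\<^sup>2 + 1 / (a i) ^ 4"
  have sub: "torus a \<subseteq> unit_sphere"
    using torus_in_sphere[OF assms(3,4)] by blast
  have "smooth_on UNIV (\<lambda>x :: complex ^ 'n. 0 + x + 0)"
    by (rule smooth_on_quadratic)
       (simp_all flip: bilinear_conv_bounded_bilinear add: bilinear_def linear_iff)
  with sub have "smooth_map (torus a) unit_sphere (\<lambda>x. x)"
    unfolding smooth_map_def by (auto intro!: exI[of _ UNIV] exI[of _ "\<lambda>x. x"])
  then have "biharmonic_submanifold (torus a) unit_sphere \<longleftrightarrow>
      (\<forall>z\<in>torus a. bitension (torus a) unit_sphere (\<lambda>x. x) z = 0)"
    using sub embedded_submanifold_torus[of a, OF assms(3)]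
    by (simp add: biharmonic_submanifold_def biharmonic_map_def embedded_submanifold_sphere)
  also have "\<dots> \<longleftrightarrow> (\<forall>z\<in>torus a. cscale ?P z = 0)"
    using bitension_torus[OF assms(3,4)] assms(2,5) by (simp add: add.commute)
  also have "\<dots> \<longleftrightarrow> (\<forall>i. ?P i = 0)"
  proof
    assume 0: "\<forall>z\<in>torus a. cscale ?P z = 0"
    have "(\<chi> i. of_real (a i)) \<in> torus a"
      using assms(3) by (simp add: torus_def less_imp_le)
    with 0 show "\<forall>i. ?P i = 0"
      using assms(3)[THEN less_imp_neq, symmetric] by (fastforce simp: vec_eq_iff)
  qed (simp add: vec_eq_iff)
  also have "\<dots> \<longleftrightarrow>
      (\<forall>i. a i * d - 1 / (a i) ^ 3 = 2 * (real n + 1) * ((real n + 1) * a i - 1 / a i))"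
  proof (intro all_cong1)
    fix i
    have "a i * d - 1 / (a i) ^ 3 - 2 * (real n + 1) * ((real n + 1) * a i - 1 / a i) = - a i * ?P i"
      using assms(3)[of i] by (simp add: field_simps power2_eq_square power3_eq_cube power4_eq_xxxx)
    then show "?P i = 0 \<longleftrightarrow>
        a i * d - 1 / (a i) ^ 3 = 2 * (real n + 1) * ((real n + 1) * a i - 1 / a i)"
      using assms(3)[of i] by auto
  qed
  finally show ?thesis .
qed

end
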